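(* Let $n\ge 1$ and $\lambda\in[1/(n+1),1/2]$. Let $P\subseteq\mathbb{R}^n$ be a polytope. Then $P\in\mathrm{VG}(\mathbb{R}^n,\lambda)$ if and only if $$P=\mathrm{cl}\left(\sum_{i=0}^\infty(1-\lambda)^i\lambda V(P)\right).$$
   Context: A polytope in $\mathbb{R}^n$ is the convex hull of a finite non-empty set of points; $V(P)$ denotes the set of vertices of $P$; $A+B=\{a+b: a\in A,b\in B\}$ is the Minkowski sum; $\mathrm{cl}$ denotes closure. The infinite sum $\sum_{i=0}^\infty(1-\lambda)^i\lambda V(P)$ is the set of all sums $\sum_{i=0}^\infty(1-\lambda)^i\lambda v_i$ with $v_i\in V(P)$ for each $i$. For a polytope $P\subset\mathbb{R}^n$ let $\lambda(P)=\sup\{\lambda\in\mathbb{R}: P=(1-\lambda)P+\lambda V(P)\}$ (value in $(-\infty,+\infty]$; it is $+\infty$ exactly when $P$ is a single point). $\mathrm{VG}(\mathbb{R}^n,\lambda)$ is the class of polytopes $P\subset\mathbb{R}^n$ with $\lambda(P)\ge\lambda$. *)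

theory Defs
  imports "HOL-Analysis.Analysis" "HOL-Library.Set_Algebras"
begin

text \<open>
  The library's \<^const>\<open>polytope\<close> admits the empty set, so nonemptiness is required here.
\<close>

definition nonempty_polytope :: "'a::euclidean_space set \<Rightarrow> bool"
  where "nonempty_polytope P \<longleftrightarrow> polytope P \<and> P \<noteq> {}"

text \<open>
  The vertices of a polytope are its extreme points, equivalently its zero-dimensional faces
  (see \<open>face_of_singleton\<close>).
\<close>

definition vertices :: "'a::euclidean_space set \<Rightarrow> 'a set"
  where "vertices P = {v. v extreme_point_of P}"

text \<open>
  The parameter is not restricted to \<open>[0,1]\<close>. The set of admissible parameters always
  contains \<open>0\<close>, so the \<^typ>\<open>ereal\<close> supremum is never \<open>-\<infinity>\<close>; it is \<open>\<infinity>\<close> when the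
  set is unbounded, as for a single point.
\<close>

definition vg_const :: "'a::euclidean_space set \<Rightarrow> ereal"
  where "vg_const P =
    Sup {ereal l | l :: real. P = ((*\<^sub>R) (1 - l) ` P) + ((*\<^sub>R) l ` vertices P)}"

definition VG :: "real \<Rightarrow> 'a::euclidean_space set set"
  where "VG l = {P. nonempty_polytope P \<and> vg_const P \<ge> ereal l}"

definition infinite_vertex_sum :: "real \<Rightarrow> 'a::euclidean_space set \<Rightarrow> 'a set"
  where "infinite_vertex_sum l P =
    {s. \<exists>v. (\<forall>i::nat. v i \<in> vertices P) \<and> (\<lambda>i. ((1 - l) ^ i * l) *\<^sub>R v i) sums s}"

end

theory Submission
  imports Defs
begin

text \<open>
  For \<open>0 < \<lambda> < 1\<close> both sides are equivalent to \<open>P = (1 - \<lambda>)P + \<lambda>V(P)\<close>. By convexity of \<open>P\<close> the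
  admissible parameters in \<open>[0,1]\<close> form an interval containing \<open>0\<close>, and it is closed because
  \<open>V(P)\<close> is finite and \<open>P\<close> is closed; so \<open>\<lambda>(P) \<ge> \<lambda>\<close> means that \<open>\<lambda>\<close> itself is admissible.
  Iterating the decomposition \<open>p = (1 - \<lambda>)p' + \<lambda>v\<close> expands each \<open>p \<in> P\<close> into an infinite sum,
  with remainder \<open>(1 - \<lambda>)\<^sup>k p\<^sub>k \<longlonglongrightarrow> 0\<close>. Conversely the set \<open>S\<close> of infinite sums satisfies
  \<open>S \<subseteq> (1 - \<lambda>)S + \<lambda>V(P)\<close>, and this inclusion passes to the closure because
  \<open>(1 - \<lambda>)P + \<lambda>V(P)\<close> is compact.
\<close>

section \<open>Parameters \<open>l\<close> with \<open>P = (1 - l)P + l V(P)\<close>\<close>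

lemma mem_vertex_decomposition_iff:
  "x \<in> ((*\<^sub>R) (1 - l) ` P) + ((*\<^sub>R) l ` vertices P) \<longleftrightarrow>
    (\<exists>p\<in>P. \<exists>v\<in>vertices P. x = (1 - l) *\<^sub>R p + l *\<^sub>R v)"
  by (auto simp: set_plus_def)

lemma vertices_subset: "vertices P \<subseteq> P"
  by (auto simp: vertices_def extreme_point_of_def)

lemma finite_vertices:
  assumes "polytope P"
  shows "finite (vertices P)"
  using finite_polyhedron_extreme_points[OF polytope_imp_polyhedron[OF assms]]
  by (simp add: vertices_def)

lemma vertices_nonempty:
  assumes "nonempty_polytope P"
  shows "vertices P \<noteq> {}"
  using assms extreme_point_exists_convex[of P]
  by (auto simp: nonempty_polytope_def vertices_def polytope_imp_compact polytope_imp_convex)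

lemma vertex_decomposition_subset:
  assumes "convex P" "0 \<le> l" "l \<le> 1"
  shows "((*\<^sub>R) (1 - l) ` P) + ((*\<^sub>R) l ` vertices P) \<subseteq> P"
proof
  fix x assume "x \<in> ((*\<^sub>R) (1 - l) ` P) + ((*\<^sub>R) l ` vertices P)"
  then obtain p v where "p \<in> P" "v \<in> P" "x = (1 - l) *\<^sub>R p + l *\<^sub>R v"
    using vertices_subset[of P] unfolding mem_vertex_decomposition_iff by auto
  then show "x \<in> P"
    using convexD[OF assms(1), of p v "1 - l" l] assms by simp
qed

text \<open>The same vertex \<open>v\<close> serves for both parameters: the excess weight
  \<open>m - l\<close> on \<open>v\<close> is moved into \<open>q\<close>. After division by
  \<open>1 - l\<close> this makes \<open>q\<close> a convex combination of \<open>p\<close> and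
  \<open>v\<close>. If \<open>l = 1\<close>, then \<open>m = 1\<close> too and nothing has to be
  moved.\<close>

lemma vertex_decomposition_mono:
  assumes "convex P" "0 \<le> l" "l \<le> m" "m \<le> 1"
    and "p \<in> P" "v \<in> vertices P"
  shows "\<exists>q\<in>P. (1 - m) *\<^sub>R p + m *\<^sub>R v = (1 - l) *\<^sub>R q + l *\<^sub>R v"
proof (cases "l = 1")
  case True
  then show ?thesis using assms by auto
next
  case False
  then have l1: "1 - l > 0" using assms by simp
  let ?q = "((1 - m) / (1 - l)) *\<^sub>R p + ((m - l) / (1 - l)) *\<^sub>R v"
  have "?q \<in> P"
    using l1 assms vertices_subset[of P]
    by (intro convexD[OF assms(1)]) (auto simp: add_divide_distrib[symmetric])
  moreover have "(1 - l) *\<^sub>R ?q = (1 - m) *\<^sub>R p + (m - l) *\<^sub>R v"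
    using l1 by (simp add: scaleR_add_right)
  then have "(1 - m) *\<^sub>R p + m *\<^sub>R v = (1 - l) *\<^sub>R ?q + l *\<^sub>R v"
    by (simp add: algebra_simps)
  ultimately show ?thesis by blast
qed

text \<open>Since \<open>vg_const\<close> ranges over all real parameters, those above 1 must be
  handled. For \<open>m > 1\<close> the point \<open>(1 - m)p + m v\<close> lies beyond
  \<open>v\<close> on the ray from \<open>p\<close>, so \<open>v\<close> would be interior to a
  segment in \<open>P\<close>, against extremality.\<close>

lemma parameter_gt_1_imp_singleton:
  assumes "nonempty_polytope P" "m > 1"
    and dec: "P = ((*\<^sub>R) (1 - m) ` P) + ((*\<^sub>R) m ` vertices P)"
  shows "\<exists>v. P = {v} \<and> vertices P = {v}"
proof -
  obtain v where v: "v \<in> vertices P"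
    using vertices_nonempty[OF assms(1)] by blast
  have "p = v" if p: "p \<in> P" for p
  proof (rule ccontr)
    assume ne: "p \<noteq> v"
    let ?q = "(1 - m) *\<^sub>R p + m *\<^sub>R v"
    have "?q \<in> P"
      using dec mem_vertex_decomposition_iff[of ?q m P] p v by blast
    moreover have "v \<in> open_segment p ?q"
    proof -
      \<comment> \<open>The definition of \<open>?q\<close> solved for \<open>v\<close>; the weight
        \<open>1 / m\<close> lies strictly between 0 and 1 because \<open>m > 1\<close>.\<close>
      have "v = (1 - 1 / m) *\<^sub>R p + (1 / m) *\<^sub>R ?q"
        using \<open>m > 1\<close> by (simp add: algebra_simps diff_divide_distrib)
      moreover have "p \<noteq> ?q"
      proof
        assume "p = ?q"
        then have "m *\<^sub>R (v - p) = 0"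
          by (simp add: scaleR_diff_right scaleR_diff_left)
        then show False using ne \<open>m > 1\<close> by auto
      qed
      ultimately show ?thesis
        unfolding in_segment using \<open>m > 1\<close> by (intro conjI exI[of _ "1 / m"]) auto
    qed
    ultimately show False
      using v p by (auto simp: vertices_def extreme_point_of_def)
  qed
  then show ?thesis
    using v vertices_subset[of P] by blast
qed

lemma vertex_decomposition_antimono:
  assumes P: "nonempty_polytope P" and l: "0 \<le> l" "l \<le> 1" "l \<le> m"
    and dec: "P = ((*\<^sub>R) (1 - m) ` P) + ((*\<^sub>R) m ` vertices P)"
  shows "P = ((*\<^sub>R) (1 - l) ` P) + ((*\<^sub>R) l ` vertices P)"
proof (cases "m \<le> 1")
  case True
  have cvx: "convex P"
    using P by (simp add: nonempty_polytope_def polytope_imp_convex)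
  have "P \<subseteq> ((*\<^sub>R) (1 - l) ` P) + ((*\<^sub>R) l ` vertices P)"
  proof
    fix x assume "x \<in> P"
    then obtain p v where "p \<in> P" "v \<in> vertices P" "x = (1 - m) *\<^sub>R p + m *\<^sub>R v"
      using dec mem_vertex_decomposition_iff[of x m P] by blast
    then show "x \<in> ((*\<^sub>R) (1 - l) ` P) + ((*\<^sub>R) l ` vertices P)"
      using vertex_decomposition_mono[OF cvx l(1) l(3) True]
      unfolding mem_vertex_decomposition_iff by metis
  qed
  then show ?thesis
    using vertex_decomposition_subset[OF cvx l(1,2)] by blast
next
  case False
  \<comment> \<open>Above 1 the polytope collapses to a point, for which every parameter is
    admissible.\<close>
  then obtain v where v: "P = {v}" "vertices P = {v}"
    using parameter_gt_1_imp_singleton[OF P _ dec] by auto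
  then show ?thesis
    by (auto simp: set_plus_def scaleR_add_left[symmetric])
qed

text \<open>The vertex used for a given \<open>x\<close> may change with \<open>m\<close>, so no
  single vertex is followed to the limit. Instead, the parameters that work for \<open>x\<close>
  with some vertex form a finite union of closed sets.\<close>

lemma vertex_decomposition_limit:
  assumes P: "nonempty_polytope P" and l: "0 < l" "l < 1"
    and dec: "\<And>m. 0 \<le> m \<Longrightarrow> m < l \<Longrightarrow> P = ((*\<^sub>R) (1 - m) ` P) + ((*\<^sub>R) m ` vertices P)"
  shows "P = ((*\<^sub>R) (1 - l) ` P) + ((*\<^sub>R) l ` vertices P)"
proof -
  have poly: "polytope P" using P by (simp add: nonempty_polytope_def)
  have "P \<subseteq> ((*\<^sub>R) (1 - l) ` P) + ((*\<^sub>R) l ` vertices P)"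
  proof
    fix x assume x: "x \<in> P"
    \<comment> \<open>The vector required to lie in \<open>P\<close> is \<open>p\<close> from
      \<open>x = (1 - m)p + m v\<close>. It depends continuously on \<open>m\<close> in
      \<open>{0..l}\<close>, because \<open>l < 1\<close> keeps \<open>1 - m\<close> away from
      0.\<close>
    define T where
      "T = (\<Union>v\<in>vertices P. {0..l} \<inter> (\<lambda>m. (1 / (1 - m)) *\<^sub>R (x - m *\<^sub>R v)) -` P)"
    have "closed T"
      unfolding T_def using l poly
      by (intro closed_UN finite_vertices ballI continuous_closed_preimage continuous_intros
          polytope_imp_closed) auto
    moreover have "{0..<l} \<subseteq> T"
    proof
      fix m assume m: "m \<in> {0..<l}"
      then obtain p v where pv: "p \<in> P" "v \<in> vertices P" "x = (1 - m) *\<^sub>R p + m *\<^sub>R v"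
        using x dec[of m] mem_vertex_decomposition_iff[of x m P]
        unfolding atLeastLessThan_iff by blast
      then have "(1 / (1 - m)) *\<^sub>R (x - m *\<^sub>R v) = p"
        using m l by simp
      then have "(1 / (1 - m)) *\<^sub>R (x - m *\<^sub>R v) \<in> P"
        using pv(1) by simp
      then show "m \<in> T"
        unfolding T_def using pv(2) m by (intro UN_I[of v] IntI vimageI2) simp_all
    qed
    ultimately have "closure {0..<l} \<subseteq> T" by (rule closure_minimal[rotated])
    then have "l \<in> T" using l by auto
    then obtain v where v: "v \<in> vertices P" "(1 / (1 - l)) *\<^sub>R (x - l *\<^sub>R v) \<in> P"
      unfolding T_def by auto
    moreover have "x = (1 - l) *\<^sub>R ((1 / (1 - l)) *\<^sub>R (x - l *\<^sub>R v)) + l *\<^sub>R v"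
      using l by simp
    ultimately show "x \<in> ((*\<^sub>R) (1 - l) ` P) + ((*\<^sub>R) l ` vertices P)"
      unfolding mem_vertex_decomposition_iff by blast
  qed
  then show ?thesis
    using vertex_decomposition_subset[OF polytope_imp_convex[OF poly], of l] l
    by (intro equalityI) auto
qed

lemma mem_VG_iff:
  assumes P: "nonempty_polytope P" and l: "0 < l" "l < 1"
  shows "P \<in> VG l \<longleftrightarrow> P = ((*\<^sub>R) (1 - l) ` P) + ((*\<^sub>R) l ` vertices P)"
proof
  assume "P \<in> VG l"
  then have sup: "ereal l \<le> vg_const P" by (simp add: VG_def)
  show "P = ((*\<^sub>R) (1 - l) ` P) + ((*\<^sub>R) l ` vertices P)"
  proof (rule vertex_decomposition_limit[OF P l])
    fix m assume m: "0 \<le> m" "m < l"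
    \<comment> \<open>The supremum is not known to be attained, so admissible parameters
      \<open>k\<close> are found only above each \<open>m < l\<close>; the limit lemma then reaches
      \<open>l\<close>. Such a \<open>k\<close> may exceed 1.\<close>
    then have "ereal m < vg_const P"
      using sup by (metis ereal_less(2) less_ereal.simps(1) less_le_trans)
    then obtain e where "ereal m < e"
      and "e \<in> {ereal k | k. P = ((*\<^sub>R) (1 - k) ` P) + ((*\<^sub>R) k ` vertices P)}"
      unfolding vg_const_def less_Sup_iff by (elim bexE)
    then obtain k where e: "ereal m < e" "e = ereal k"
      and k: "P = ((*\<^sub>R) (1 - k) ` P) + ((*\<^sub>R) k ` vertices P)"
      unfolding mem_Collect_eq by (elim exE conjE)
    from e have "m \<le> k" by simp
    then show "P = ((*\<^sub>R) (1 - m) ` P) + ((*\<^sub>R) m ` vertices P)"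
      using m l by (intro vertex_decomposition_antimono[OF P _ _ _ k]) linarith+
  qed
next
  assume "P = ((*\<^sub>R) (1 - l) ` P) + ((*\<^sub>R) l ` vertices P)"
  then have "ereal l \<le> vg_const P"
    unfolding vg_const_def
    by (intro Sup_upper CollectI exI[of _ l] conjI refl)
  then show "P \<in> VG l" using P by (simp add: VG_def)
qed

section \<open>Infinite vertex sums and their closure\<close>

lemma infinite_vertex_sum_subset:
  assumes "convex P" "closed P" "0 < l" "l \<le> 1"
  shows "infinite_vertex_sum l P \<subseteq> P"
proof
  fix s assume "s \<in> infinite_vertex_sum l P"
  then obtain v where v: "\<And>i::nat. v i \<in> vertices P"
    and s: "(\<lambda>i. ((1 - l) ^ i * l) *\<^sub>R v i) sums s"
    unfolding infinite_vertex_sum_def by blast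
  have vP: "v i \<in> P" for i
    using v[of i] vertices_subset[of P] by blast
  \<comment> \<open>A remainder \<open>w\<close> in \<open>P\<close> completes the weights of a
    partial sum to 1. The claim is for all \<open>w\<close>, since the induction step merges the
    last vertex into the remainder, giving \<open>(1 - l)w + l v k\<close>.\<close>
  have partial: "(\<Sum>i<k. ((1 - l) ^ i * l) *\<^sub>R v i) + (1 - l) ^ k *\<^sub>R w \<in> P" if "w \<in> P" for k w
    using that
  proof (induction k arbitrary: w)
    case (Suc k)
    have "(1 - l) *\<^sub>R w + l *\<^sub>R v k \<in> P"
      using assms by (intro convexD[OF assms(1) Suc.prems vP]) auto
    moreover have "(1 - l) ^ k *\<^sub>R ((1 - l) *\<^sub>R w + l *\<^sub>R v k) =
        ((1 - l) ^ k * l) *\<^sub>R v k + (1 - l) ^ Suc k *\<^sub>R w"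
      by (simp add: scaleR_add_right add.commute mult.commute)
    ultimately show ?case
      using Suc.IH[of "(1 - l) *\<^sub>R w + l *\<^sub>R v k"] by (simp only: sum.lessThan_Suc add.assoc)
  qed simp
  have "(\<lambda>k. (1 - l) ^ k *\<^sub>R v 0) \<longlonglongrightarrow> 0 *\<^sub>R v 0"
    using assms by (intro tendsto_scaleR LIMSEQ_realpow_zero tendsto_const) auto
  then have "(\<lambda>k. (\<Sum>i<k. ((1 - l) ^ i * l) *\<^sub>R v i) + (1 - l) ^ k *\<^sub>R v 0) \<longlonglongrightarrow> s + 0 *\<^sub>R v 0"
    using s unfolding sums_def by (intro tendsto_add)
  then have "s + 0 *\<^sub>R v 0 \<in> P"
    by (rule closed_sequentially[OF assms(2) partial[OF vP[of 0]]])
  then show "s \<in> P" by simp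
qed

lemma subset_infinite_vertex_sum:
  assumes "bounded P" "0 < l" "l \<le> 1"
    and dec: "P \<subseteq> ((*\<^sub>R) (1 - l) ` P) + ((*\<^sub>R) l ` vertices P)"
  shows "P \<subseteq> infinite_vertex_sum l P"
proof
  fix x assume x: "x \<in> P"
  have "\<forall>p\<in>P. \<exists>q v. q \<in> P \<and> v \<in> vertices P \<and> p = (1 - l) *\<^sub>R q + l *\<^sub>R v"
    using dec mem_vertex_decomposition_iff[of _ l P] by blast
  \<comment> \<open>Choice functions: \<open>g\<close> picks the vertex and \<open>f\<close> the
    remaining point, so the orbit of \<open>x\<close> under \<open>f\<close> yields the whole vertex
    sequence.\<close>
  then obtain f g where fg: "\<And>p. p \<in> P \<Longrightarrow> f p \<in> P" "\<And>p. p \<in> P \<Longrightarrow> g p \<in> vertices P"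
    "\<And>p. p \<in> P \<Longrightarrow> p = (1 - l) *\<^sub>R f p + l *\<^sub>R g p"
    by metis
  have orbit: "(f ^^ k) x \<in> P" for k
    by (induction k) (use x fg in auto)
  define v where "v k = g ((f ^^ k) x)" for k
  have expand: "x = (\<Sum>i<k. ((1 - l) ^ i * l) *\<^sub>R v i) + (1 - l) ^ k *\<^sub>R (f ^^ k) x" for k
  proof (induction k)
    case (Suc k)
    have step: "(f ^^ k) x = (1 - l) *\<^sub>R (f ^^ Suc k) x + l *\<^sub>R v k"
      using fg(3)[OF orbit[of k]] unfolding v_def funpow.simps comp_apply .
    have "(1 - l) ^ k *\<^sub>R (f ^^ k) x =
        ((1 - l) ^ k * l) *\<^sub>R v k + (1 - l) ^ Suc k *\<^sub>R (f ^^ Suc k) x"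
      by (subst step) (simp add: scaleR_add_right add_ac mult_ac)
    then have "(\<Sum>i<k. ((1 - l) ^ i * l) *\<^sub>R v i) + (1 - l) ^ k *\<^sub>R (f ^^ k) x =
        (\<Sum>i<Suc k. ((1 - l) ^ i * l) *\<^sub>R v i) + (1 - l) ^ Suc k *\<^sub>R (f ^^ Suc k) x"
      by (simp only: sum.lessThan_Suc add.assoc)
    with Suc show ?case by (rule trans)
  qed simp
  obtain B where B: "\<And>p. p \<in> P \<Longrightarrow> norm p \<le> B"
    using assms(1) by (auto simp: bounded_iff)
  have "(\<lambda>k. (1 - l) ^ k *\<^sub>R (f ^^ k) x) \<longlonglongrightarrow> 0"
  proof (rule Lim_null_comparison)
    show "\<forall>\<^sub>F k in sequentially. norm ((1 - l) ^ k *\<^sub>R (f ^^ k) x) \<le> (1 - l) ^ k * B"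
      using assms B[OF orbit] by (intro always_eventually allI) (simp add: mult_left_mono)
    have "(\<lambda>k. (1 - l) ^ k * B) \<longlonglongrightarrow> 0 * B"
      using assms by (intro tendsto_mult LIMSEQ_realpow_zero tendsto_const) auto
    then show "(\<lambda>k. (1 - l) ^ k * B) \<longlonglongrightarrow> 0" by simp
  qed
  then have "(\<lambda>k. x - (1 - l) ^ k *\<^sub>R (f ^^ k) x) \<longlonglongrightarrow> x - 0"
    by (intro tendsto_diff tendsto_const)
  moreover have "x - (1 - l) ^ k *\<^sub>R (f ^^ k) x = (\<Sum>i<k. ((1 - l) ^ i * l) *\<^sub>R v i)" for k
    by (rule iffD2[OF diff_eq_eq expand])
  ultimately have "(\<lambda>i. ((1 - l) ^ i * l) *\<^sub>R v i) sums x"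
    by (simp add: sums_def)
  moreover have "v k \<in> vertices P" for k
    using fg(2)[OF orbit] by (simp add: v_def)
  ultimately show "x \<in> infinite_vertex_sum l P"
    unfolding infinite_vertex_sum_def by blast
qed

text \<open>Removing the first term and dividing by \<open>1 - l\<close> leaves a series of the same
  form, with the vertex sequence shifted by one.\<close>

lemma infinite_vertex_sum_shift:
  assumes "l < 1"
  shows "infinite_vertex_sum l P \<subseteq>
    ((*\<^sub>R) (1 - l) ` infinite_vertex_sum l P) + ((*\<^sub>R) l ` vertices P)"
proof
  fix s assume "s \<in> infinite_vertex_sum l P"
  then obtain v where v: "\<And>i::nat. v i \<in> vertices P"
    and s: "(\<lambda>i. ((1 - l) ^ i * l) *\<^sub>R v i) sums s"
    unfolding infinite_vertex_sum_def by blast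
  let ?t = "(1 / (1 - l)) *\<^sub>R (s - l *\<^sub>R v 0)"
  have "(\<lambda>i. ((1 - l) ^ Suc i * l) *\<^sub>R v (Suc i)) sums (s - l *\<^sub>R v 0)"
    using s sums_Suc_iff[of "\<lambda>i. ((1 - l) ^ i * l) *\<^sub>R v i"] by simp
  from sums_scaleR_right[OF this, of "1 / (1 - l)"]
  have "(\<lambda>i. ((1 - l) ^ i * l) *\<^sub>R v (Suc i)) sums ?t"
    using assms by simp
  then have "?t \<in> infinite_vertex_sum l P"
    unfolding infinite_vertex_sum_def using v by (auto intro!: exI[of _ "\<lambda>i. v (Suc i)"])
  moreover have "s = (1 - l) *\<^sub>R ?t + l *\<^sub>R v 0"
    using assms by simp
  ultimately show "s \<in> ((*\<^sub>R) (1 - l) ` infinite_vertex_sum l P) + ((*\<^sub>R) l ` vertices P)"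
    using v[of 0] by (metis imageI set_plus_intro)
qed

lemma vertex_decomposition_iff_closure:
  assumes "nonempty_polytope P" and l: "0 < l" "l < 1"
  shows "P = ((*\<^sub>R) (1 - l) ` P) + ((*\<^sub>R) l ` vertices P) \<longleftrightarrow>
    P = closure (infinite_vertex_sum l P)"
proof
  have poly: "polytope P" using assms by (simp add: nonempty_polytope_def)
  note facts = polytope_imp_convex[OF poly] polytope_imp_closed[OF poly]
    polytope_imp_bounded[OF poly] polytope_imp_compact[OF poly]
  {
    assume "P = ((*\<^sub>R) (1 - l) ` P) + ((*\<^sub>R) l ` vertices P)"
    then have "P \<subseteq> infinite_vertex_sum l P"
      by (intro subset_infinite_vertex_sum[OF facts(3) l(1) less_imp_le[OF l(2)]]) (rule equalityD1)
    moreover have "infinite_vertex_sum l P \<subseteq> P"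
      using facts l by (intro infinite_vertex_sum_subset) auto
    \<comment> \<open>In this direction the sums already fill \<open>P\<close>, so the closure adds
      nothing.\<close>
    ultimately have "infinite_vertex_sum l P = P" by blast
    then show "P = closure (infinite_vertex_sum l P)"
      using facts by simp
  next
    assume cl: "P = closure (infinite_vertex_sum l P)"
    let ?D = "((*\<^sub>R) (1 - l) ` P) + ((*\<^sub>R) l ` vertices P)"
    \<comment> \<open>\<open>?D\<close> is the image under addition of the product of a compact set
      and a finite one, hence compact.\<close>
    have "closed ?D"
      using facts finite_vertices[OF poly]
      by (simp add: set_plus_image case_prod_unfold compact_imp_closed compact_continuous_image
          compact_Times compact_scaling finite_imp_compact continuous_intros)
    moreover have "infinite_vertex_sum l P \<subseteq> ?D"
    proof -
      have "infinite_vertex_sum l P \<subseteq> P"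
        using cl closure_subset by blast
      then show ?thesis
        using infinite_vertex_sum_shift[OF l(2), of P]
        by (meson image_mono order_refl order_trans set_plus_mono2)
    qed
    ultimately have "P \<subseteq> ?D"
      using cl closure_minimal by metis
    moreover have "?D \<subseteq> P"
      using vertex_decomposition_subset[OF facts(1), of l] l by simp
    ultimately show "P = ?D" by (rule equalityI)
  }
qed

theorem proposition6p1:
  fixes P :: "(real ^ 'n) set" and l :: real
  assumes "1 / (real CARD('n) + 1) \<le> l" and "l \<le> 1 / 2"
    and "nonempty_polytope P"
  shows "P \<in> VG l \<longleftrightarrow> P = closure (infinite_vertex_sum l P)"
proof -
  have "0 < 1 / (real CARD('n) + 1)" by simp
  then have l: "0 < l" "l < 1" using assms by linarith+
  show ?thesis
    using mem_VG_iff[OF assms(3) l] vertex_decomposition_iff_closure[OF assms(3) l] by (rule trans)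
qed

end
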